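(* Let $\mathfrak g$ be a $5$-dimensional real Lie algebra, let $\alpha,\beta\in\mathfrak g^*$ be linearly independent, and set $V=\ker\left(L_\alpha\colon\Lambda^3\mathfrak g^*\to\Lambda^4\mathfrak g^*\right)\cap Z^3$. Suppose that either (i) $\dim L_\beta(V)<2$; or (ii) $\dim L_\beta(V)=2$ and $L_\alpha(L_\beta(Z^2))\subset L_\beta(V)$. Then there is no hypo structure on $\mathfrak g$ of the form $(\alpha,\omega_1,\omega_2,\omega_3)$, i.e. no hypo structure whose almost-contact form is $\alpha$ itself.
   Context: For a Lie algebra $\mathfrak g$, $d$ denotes the Chevalley--Eilenberg differential on $\Lambda^*\mathfrak g^*$, and $Z^k\subset\Lambda^k\mathfrak g^*$ is the space of closed $k$-forms. For $\gamma\in\mathfrak g^*$, $L_\gamma\colon\Lambda^j\mathfrak g^*\to\Lambda^{j+1}\mathfrak g^*$ is the map $L_\gamma(\eta)=\gamma\wedge\eta$. A hypo structure on a $5$-dimensional Lie algebra $\mathfrak g$ is a quadruplet $(\alpha,\omega_1,\omega_2,\omega_3)$, with $\alpha\in\mathfrak g^*$ and $\omega_i\in\Lambda^2\mathfrak g^*$, for which there is a basis $f^1,\dots,f^5$ of $\mathfrak g^*$ such that $$\alpha=f^5,\quad \omega_1=f^{12}+f^{34},\quad \omega_2=f^{13}+f^{42},\quad \omega_3=f^{14}+f^{23}\qquad (f^{ij}=f^i\wedge f^j),$$ and such that $d\omega_1=0$, $d(\omega_2\wedge\alpha)=0$ and $d(\omega_3\wedge\alpha)=0$. The $1$-form $\alpha$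 is called its almost-contact form. *)

theory Defs
  imports "HOL-Analysis.Analysis" "HOL-Library.Function_Algebras"
begin

text \<open>Real-vector-space structure on functions, extending the pointwise group structure of
  \<^theory>\<open>HOL-Library.Function_Algebras\<close>.\<close>

instantiation "fun" :: (type, real_vector) real_vector
begin

definition scaleR_fun :: "real \<Rightarrow> ('a \<Rightarrow> 'b) \<Rightarrow> 'a \<Rightarrow> 'b" where
  "scaleR_fun c f = (\<lambda>x. c *\<^sub>R f x)"

instance
  by standard (simp_all add: scaleR_fun_def fun_eq_iff scaleR_add_right scaleR_add_left)

end

locale lie_algebra =
  fixes bracket :: "'g::real_vector \<Rightarrow> 'g \<Rightarrow> 'g"
  assumes bilinear_bracket: "bilinear bracket"
    and bracket_self: "bracket x x = 0"
    and jacobi: "bracket x (bracket y z) + bracket y (bracket z x) + bracket z (bracket x y) = 0"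

text \<open>An exterior form is a function on argument lists. A form that is homogeneous of degree
  \<open>k\<close> is set to 0 on all lists whose length is not \<open>k\<close>, so that the degree is part of the form.\<close>

type_synonym 'g form = "'g list \<Rightarrow> real"

definition alt_forms :: "nat \<Rightarrow> 'g::real_vector form set" where
  "alt_forms k = {\<omega>.
     (\<forall>xs. length xs \<noteq> k \<longrightarrow> \<omega> xs = 0) \<and>
     (\<forall>xs i. length xs = k \<and> i < k \<longrightarrow> linear (\<lambda>v. \<omega> (xs[i := v]))) \<and>
     (\<forall>xs i j. length xs = k \<and> i < j \<and> j < k \<and> xs ! i = xs ! j \<longrightarrow> \<omega> xs = 0)}"

text \<open>The exterior product in its shuffle form, normalised by
  \<open>(\<alpha> \<and> \<beta>)(x,y) = \<alpha>(x) \<beta>(y) - \<alpha>(y) \<beta>(x)\<close> for 1-forms. The set \<open>I\<close> holds the positions of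
  the arguments passed to the first factor; since homogeneous forms vanish on lists of the wrong
  length, only the sets \<open>I\<close> of the right cardinality contribute.\<close>

definition shuffle_sign :: "nat set \<Rightarrow> real" where
  "shuffle_sign I = (-1) ^ card {(i, j). i \<in> I \<and> j < i \<and> j \<notin> I}"

definition wedge :: "'g form \<Rightarrow> 'g form \<Rightarrow> 'g form"  (infixr "\<and>\<^sub>\<Lambda>" 75) where
  "\<eta> \<and>\<^sub>\<Lambda> \<zeta> = (\<lambda>xs. \<Sum>I\<in>Pow {..<length xs}.
     shuffle_sign I * \<eta> (nths xs I) * \<zeta> (nths xs (- I)))"

text \<open>The Chevalley--Eilenberg differential (trivial coefficients):
  \<open>d\<omega>(x\<^sub>0,\<dots>,x\<^sub>k) = \<Sum>\<^bsub>i<j\<^esub> (-1)\<^bsup>i+j\<^esup> \<omega>([x\<^sub>i,x\<^sub>j], x\<^sub>0,\<dots>,x\<^sub>k)\<close>,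
  the arguments \<open>x\<^sub>i\<close> and \<open>x\<^sub>j\<close> being omitted after the bracket.\<close>

definition ce_diff :: "('g \<Rightarrow> 'g \<Rightarrow> 'g) \<Rightarrow> 'g form \<Rightarrow> 'g form" where
  "ce_diff bracket \<omega> = (\<lambda>xs. \<Sum>j<length xs. \<Sum>i<j.
     (-1) ^ (i + j) * \<omega> (bracket (xs ! i) (xs ! j) # nths xs (- {i, j})))"

definition closed_forms :: "('g::real_vector \<Rightarrow> 'g \<Rightarrow> 'g) \<Rightarrow> nat \<Rightarrow> 'g form set" where
  "closed_forms bracket k = {\<omega> \<in> alt_forms k. ce_diff bracket \<omega> = 0}"

definition L_op :: "'g form \<Rightarrow> 'g form \<Rightarrow> 'g form" where
  "L_op \<gamma> \<eta> = \<gamma> \<and>\<^sub>\<Lambda> \<eta>"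

definition L_ker :: "'g::real_vector form \<Rightarrow> nat \<Rightarrow> 'g form set" where
  "L_ker \<gamma> j = {\<eta> \<in> alt_forms j. L_op \<gamma> \<eta> = 0}"

definition dual_basis5 :: "(nat \<Rightarrow> 'g::real_vector form) \<Rightarrow> bool" where
  "dual_basis5 f \<longleftrightarrow>
     inj_on f {1..5} \<and> independent (f ` {1..5}) \<and> span (f ` {1..5}) = alt_forms 1"

definition hypo_structure ::
  "('g::real_vector \<Rightarrow> 'g \<Rightarrow> 'g) \<Rightarrow> 'g form \<Rightarrow> 'g form \<Rightarrow> 'g form \<Rightarrow> 'g form \<Rightarrow> bool" where
  "hypo_structure bracket \<alpha> \<omega>\<^sub>1 \<omega>\<^sub>2 \<omega>\<^sub>3 \<longleftrightarrow>
     (\<exists>f. dual_basis5 f \<and>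
        \<alpha> = f 5 \<and>
        \<omega>\<^sub>1 = f 1 \<and>\<^sub>\<Lambda> f 2 + f 3 \<and>\<^sub>\<Lambda> f 4 \<and>
        \<omega>\<^sub>2 = f 1 \<and>\<^sub>\<Lambda> f 3 + f 4 \<and>\<^sub>\<Lambda> f 2 \<and>
        \<omega>\<^sub>3 = f 1 \<and>\<^sub>\<Lambda> f 4 + f 2 \<and>\<^sub>\<Lambda> f 3) \<and>
     ce_diff bracket \<omega>\<^sub>1 = 0 \<and>
     ce_diff bracket (\<omega>\<^sub>2 \<and>\<^sub>\<Lambda> \<alpha>) = 0 \<and>
     ce_diff bracket (\<omega>\<^sub>3 \<and>\<^sub>\<Lambda> \<alpha>) = 0"

end

theory Submission
  imports Defs
begin

text \<open>
  Suppose that \<open>(\<alpha>, \<omega>\<^sub>1, \<omega>\<^sub>2, \<omega>\<^sub>3)\<close> is a hypo structure, and consider the linear map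
  \<open>N \<omega> = \<alpha> \<and> (\<beta> \<and> \<omega>)\<close> on 2-forms. Everything rests on the fact that \<open>N\<close> is injective on the span
  of \<open>\<omega>\<^sub>1, \<omega>\<^sub>2, \<omega>\<^sub>3\<close> (lemma \<open>hypo_wedge_injective\<close>). This holds because every nonzero combination
  of the \<open>\<omega>\<^sub>i\<close> restricts to a nondegenerate form on the 4-dimensional kernel of \<open>\<alpha>\<close>, so its product with
  a nonzero 1-form there is nonzero, and \<open>\<beta>\<close> restricts to a nonzero 1-form because it is not a
  multiple of \<open>\<alpha>\<close>.

  For \<open>i = 2, 3\<close> the form \<open>\<omega>\<^sub>i \<and> \<alpha>\<close> is closed and is killed by \<open>\<alpha>\<close>, hence lies in \<open>V\<close>; moving
  \<open>\<alpha>\<close> to the front gives \<open>L_op \<beta> (\<omega>\<^sub>i \<and> \<alpha>) = - N \<omega>\<^sub>i\<close> (lemma \<open>wedge_1_2_1_shift\<close>). So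
  \<open>L_op \<beta> V\<close> spans a space that contains the independent forms \<open>N \<omega>\<^sub>2\<close> and \<open>N \<omega>\<^sub>3\<close>, and its
  dimension is at least 2. In the case of dimension exactly 2, the remaining condition on the closed
  2-forms, applied to \<open>\<omega>\<^sub>1\<close>, puts \<open>N \<omega>\<^sub>1\<close> there as well, and three independent vectors do not fit.

  The dimension counts are meaningful only in finite dimension, so the first part shows that
  \<open>alt_forms k\<close> is finite-dimensional when the underlying space is
  (lemma \<open>finite_dim_alt_forms\<close>). The injectivity is checked by evaluating forms on vectors
  dual to the given coframe; these exist by lemma \<open>independent_functionals_dual_vectors\<close>.
\<close>

section \<open>Spaces of alternating forms\<close>

lemma scaleR_fun_apply [simp]: "(c *\<^sub>R f) x = c *\<^sub>R f x"
  by (simp add: scaleR_fun_def)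

lemma sum_fun_apply: "(\<Sum>i\<in>I. f i) x = (\<Sum>i\<in>I. f i x)"
  by (induction I rule: infinite_finite_induct) auto

lemma subspace_alt_forms: "subspace (alt_forms k)"
proof -
  have "linear (\<lambda>v. c * g v)" if "linear g" for c and g :: "'a::real_vector \<Rightarrow> real"
    using linear_compose_scale_right[OF that, of c] by simp
  then show ?thesis
    unfolding subspace_def alt_forms_def
    by (auto intro!: linear_compose_add simp: linear_zero)
qed

lemma alt_forms_length: "\<omega> \<in> alt_forms k \<Longrightarrow> length xs \<noteq> k \<Longrightarrow> \<omega> xs = 0"
  by (auto simp: alt_forms_def)

text \<open>Separating the degree from multilinearity makes the degree count for products independent of
  any proof that products are alternating.\<close>

definition homogeneous :: "nat \<Rightarrow> 'g form \<Rightarrow> bool" where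
  "homogeneous k \<omega> \<longleftrightarrow> (\<forall>xs. length xs \<noteq> k \<longrightarrow> \<omega> xs = 0)"

lemma homogeneous_alt_forms: "\<omega> \<in> alt_forms k \<Longrightarrow> homogeneous k \<omega>"
  by (auto simp: alt_forms_def homogeneous_def)

lemma homogeneous_uminus: "homogeneous k \<omega> \<Longrightarrow> homogeneous k (- \<omega>)"
  by (simp add: homogeneous_def)

lemma homogeneous_zero: "homogeneous k 0"
  by (simp add: homogeneous_def)

lemma homogeneous_eqI:
  assumes "homogeneous k \<eta>" "homogeneous k \<zeta>" "\<And>xs. length xs = k \<Longrightarrow> \<eta> xs = \<zeta> xs"
  shows "\<eta> = \<zeta>"
proof
  fix xs show "\<eta> xs = \<zeta> xs"
    using assms by (cases "length xs = k") (auto simp: homogeneous_def)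
qed

lemma alt_forms_linear:
  "\<omega> \<in> alt_forms k \<Longrightarrow> length xs = k \<Longrightarrow> i < k \<Longrightarrow> linear (\<lambda>v. \<omega> (xs[i := v]))"
  by (auto simp: alt_forms_def)

lemma alt_forms_1_iff:
  "\<phi> \<in> alt_forms 1 \<longleftrightarrow> (\<forall>xs. length xs \<noteq> 1 \<longrightarrow> \<phi> xs = 0) \<and> linear (\<lambda>v. \<phi> [v])"
proof
  assume \<phi>: "\<phi> \<in> alt_forms 1"
  show "(\<forall>xs. length xs \<noteq> 1 \<longrightarrow> \<phi> xs = 0) \<and> linear (\<lambda>v. \<phi> [v])"
    using alt_forms_length[OF \<phi>] alt_forms_linear[OF \<phi>, of "[0]" 0] by simp
qed (auto simp: alt_forms_def length_Suc_conv)

lemma alt_forms_2_iff: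
  "\<eta> \<in> alt_forms 2 \<longleftrightarrow> (\<forall>xs. length xs \<noteq> 2 \<longrightarrow> \<eta> xs = 0) \<and>
     (\<forall>y. linear (\<lambda>x. \<eta> [x, y])) \<and> (\<forall>x. linear (\<lambda>y. \<eta> [x, y])) \<and> (\<forall>x. \<eta> [x, x] = 0)"
  (is "_ \<longleftrightarrow> ?R")
proof
  assume \<eta>: "\<eta> \<in> alt_forms 2"
  have "linear (\<lambda>x. \<eta> [x, y])" for y
    using alt_forms_linear[OF \<eta>, of "[0, y]" 0] by simp
  moreover have "linear (\<lambda>y. \<eta> [x, y])" for x
    using alt_forms_linear[OF \<eta>, of "[x, 0]" 1] by simp
  moreover have "\<eta> [x, x] = 0" for x
  proof -
    have "length [x, x] = 2 \<and> (0::nat) < 1 \<and> (1::nat) < 2 \<and> [x, x] ! 0 = [x, x] ! 1" by simp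
    then show ?thesis using \<eta> unfolding alt_forms_def by blast
  qed
  ultimately show ?R
    using alt_forms_length[OF \<eta>] by blast
next
  assume ?R
  then show "\<eta> \<in> alt_forms 2"
    by (auto simp: alt_forms_def length_Suc_conv numeral_2_eq_2 less_Suc_eq)
qed

lemma alt_forms_2_swap:
  assumes "\<eta> \<in> alt_forms 2" shows "\<eta> [y, x] = - \<eta> [x, y]"
proof -
  have lin: "linear (\<lambda>x. \<eta> [x, y])" "linear (\<lambda>y. \<eta> [x, y])" and diag: "\<eta> [x, x] = 0" for x y
    using assms unfolding alt_forms_2_iff by blast+
  have "\<eta> [x + y, x + y] = \<eta> [x, x] + \<eta> [x, y] + (\<eta> [y, x] + \<eta> [y, y])"
    by (simp add: linear_add[OF lin(1)] linear_add[OF lin(2)])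
  then show ?thesis by (simp add: diag)
qed

lemma alt_forms_3_iff:
  "\<eta> \<in> alt_forms 3 \<longleftrightarrow> (\<forall>xs. length xs \<noteq> 3 \<longrightarrow> \<eta> xs = 0) \<and>
     (\<forall>y z. linear (\<lambda>x. \<eta> [x, y, z])) \<and> (\<forall>x z. linear (\<lambda>y. \<eta> [x, y, z])) \<and>
     (\<forall>x y. linear (\<lambda>z. \<eta> [x, y, z])) \<and>
     (\<forall>x y. \<eta> [x, x, y] = 0 \<and> \<eta> [x, y, x] = 0 \<and> \<eta> [y, x, x] = 0)"
  (is "_ \<longleftrightarrow> ?R")
proof
  assume \<eta>: "\<eta> \<in> alt_forms 3"
  have "linear (\<lambda>x. \<eta> [x, y, z])" for y z
    using alt_forms_linear[OF \<eta>, of "[0, y, z]" 0] by simp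
  moreover have "linear (\<lambda>y. \<eta> [x, y, z])" for x z
    using alt_forms_linear[OF \<eta>, of "[x, 0, z]" 1] by simp
  moreover have "linear (\<lambda>z. \<eta> [x, y, z])" for x y
    using alt_forms_linear[OF \<eta>, of "[x, y, 0]" 2] by (simp add: numeral_2_eq_2)
  moreover have "\<eta> xs = 0" if "length xs = 3" "i < j" "j < 3" "xs ! i = xs ! j" for xs i j
    using \<eta> that unfolding alt_forms_def by blast
  from this[of "[_, _, _]" 0 1] this[of "[_, _, _]" 0 2] this[of "[_, _, _]" 1 2]
  have "\<eta> [x, x, y] = 0 \<and> \<eta> [x, y, x] = 0 \<and> \<eta> [y, x, x] = 0" for x y
    by (simp add: numeral_2_eq_2)
  ultimately show ?R
    using alt_forms_length[OF \<eta>] by blast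
next
  assume ?R
  then show "\<eta> \<in> alt_forms 3"
    by (auto simp: alt_forms_def length_Suc_conv numeral_3_eq_3 less_Suc_eq)
qed

text \<open>Multilinearity allows the entries of the argument list to be released one at a time: the
  induction is on the length \<open>m\<close> of the prefix that may contain arbitrary vectors, and position \<open>m\<close>
  is released because a linear functional that vanishes on \<open>B\<close> vanishes on its span.\<close>

lemma alt_form_eq_0_if_0_on_basis:
  assumes \<omega>: "\<omega> \<in> alt_forms k" and B: "span B = UNIV"
    and zero: "\<And>xs. length xs = k \<Longrightarrow> set xs \<subseteq> B \<Longrightarrow> \<omega> xs = 0"
  shows "\<omega> = 0"
proof -
  have "\<omega> xs = 0" if "m \<le> k" "length xs = k" "set (drop m xs) \<subseteq> B" for m xs
    using that
  proof (induction m arbitrary: xs)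
    case 0
    then show ?case using zero by simp
  next
    case (Suc m)
    have "\<omega> (xs[m := b]) = 0" if "b \<in> B" for b
    proof (rule Suc.IH)
      have "drop m (xs[m := b]) = b # drop (Suc m) xs"
        using Suc.prems by (simp add: drop_update_swap Cons_nth_drop_Suc[symmetric])
      then show "set (drop m (xs[m := b])) \<subseteq> B"
        using Suc.prems that by simp
    qed (use Suc.prems in auto)
    then have "\<omega> (xs[m := v]) = 0" for v
      using linear_eq_0_on_span[OF alt_forms_linear[OF \<omega>, of xs m], of B v] B Suc.prems by simp
    from this[of "xs ! m"] show ?case by simp
  qed
  from this[of k] have "\<omega> xs = 0" for xs
    using alt_forms_length[OF \<omega>, of xs] by (cases "length xs = k") auto
  then show ?thesis by (simp add: fun_eq_iff)
qed

text \<open>Restricting a form to the finitely many argument lists with entries in \<open>B\<close> is a linear map,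
  injective by the preceding lemma, into the space spanned by finitely many indicator functions.\<close>

lemma finite_dim_alt_forms:
  fixes B :: "'g::real_vector set"
  assumes B: "finite B" "span B = UNIV"
  obtains G :: "'g form set" where "finite G" "alt_forms k \<subseteq> span G"
proof -
  define F where "F = {xs. set xs \<subseteq> B \<and> length xs = k}"
  have finF: "finite F" unfolding F_def using B(1) by (rule finite_lists_length_eq)
  define R :: "'g form \<Rightarrow> 'g form" where "R \<omega> = (\<lambda>xs. if xs \<in> F then \<omega> xs else 0)" for \<omega>
  define ind :: "'g list \<Rightarrow> 'g form" where "ind x = (\<lambda>xs. if xs = x then 1 else 0)" for x
  have linR: "linear R"
    by (rule linearI) (auto simp: R_def fun_eq_iff)
  have R_span: "R \<omega> \<in> span (ind ` F)" for \<omega>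
  proof -
    have "R \<omega> = (\<Sum>x\<in>F. \<omega> x *\<^sub>R ind x)"
      by (auto simp: R_def ind_def fun_eq_iff sum_fun_apply finF if_distrib cong: if_cong)
    then show ?thesis by (simp add: span_sum span_scale span_base)
  qed
  have injR: "inj_on R (alt_forms k)"
    unfolding linear_inj_on_iff_eq_0[OF linR subspace_alt_forms]
    using alt_form_eq_0_if_0_on_basis[OF _ B(2)]
    by (metis (mono_tags, lifting) F_def R_def mem_Collect_eq zero_fun_apply)
  obtain A :: "'g form set" where A: "A \<subseteq> alt_forms k" "independent A" "alt_forms k \<subseteq> span A"
    using maximal_independent_subset by blast
  have spanA: "span A \<subseteq> alt_forms k"
    using A(1) subspace_alt_forms by (rule span_minimal)
  have "independent (R ` A)"
    using linear_independent_injective_image linR A(2) injR spanA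
    by (meson inj_on_subset linear_inj_on_span_independent_image)
  then have "finite (R ` A)"
    using independent_span_bound[OF finite_imageI[OF finF]] R_span by blast
  then have "finite A"
    using injR A(1) finite_imageD inj_on_subset by blast
  with A(3) that show ?thesis by blast
qed

text \<open>The functionals combine to a map into Euclidean space. Were it not onto, a vector \<open>a\<close> orthogonal
  to its image would be a linear relation between the functionals; so it is onto, and preimages of
  the standard basis vectors are dual to the family.\<close>

lemma independent_functionals_dual_vectors:
  fixes \<phi> :: "'n::finite \<Rightarrow> 'g::real_vector form"
  assumes \<phi>: "\<And>i. \<phi> i \<in> alt_forms 1" and "inj \<phi>" "independent (range \<phi>)"
  obtains e where "\<And>i j. \<phi> i [e j] = (if i = j then 1 else 0)"
proof -
  define T :: "'g \<Rightarrow> real ^ 'n" where "T v = (\<chi> i. \<phi> i [v])" for v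
  have lin: "linear (\<lambda>v. \<phi> i [v])" for i
    using \<phi> unfolding alt_forms_1_iff by blast
  have "linear T"
    by (rule linearI)
      (simp_all add: T_def vec_eq_iff linear_add[OF lin] linear_cmul[OF lin])
  then have sub: "span (range T) = range T"
    by (simp add: linear_subspace_image span_eq_iff)
  have "range T = UNIV"
  proof (rule ccontr)
    assume "range T \<noteq> UNIV"
    then obtain a where a: "a \<noteq> 0" "\<And>x. x \<in> range T \<Longrightarrow> a \<bullet> x = 0"
      using span_not_UNIV_orthogonal[of "range T"] sub by metis
    have "(\<Sum>i\<in>UNIV. a $ i *\<^sub>R \<phi> i) xs = 0" for xs
    proof (cases "length xs = 1")
      case True
      then obtain v where "xs = [v]" by (auto simp: length_Suc_conv)
      then show ?thesis using a(2)[of "T v"] by (simp add: T_def inner_vec_def sum_fun_apply)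
    next
      case False
      then show ?thesis using alt_forms_length[OF \<phi>] by (simp add: sum_fun_apply)
    qed
    then have "(\<Sum>i\<in>UNIV. a $ i *\<^sub>R \<phi> i) = 0" by (simp add: fun_eq_iff)
    then have "(\<Sum>x\<in>range \<phi>. a $ inv \<phi> x *\<^sub>R x) = 0"
      by (simp add: sum.reindex \<open>inj \<phi>\<close>)
    then have "\<forall>x\<in>range \<phi>. a $ inv \<phi> x = 0"
      using assms(3) by (auto simp: dependent_finite)
    then show False using a(1) \<open>inj \<phi>\<close> by (simp add: vec_eq_iff)
  qed
  then have "\<exists>v. T v = axis j 1" for j by (metis UNIV_I rangeE)
  then obtain e where "\<And>j. T (e j) = axis j 1" by metis
  then have "T (e j) $ i = (if i = j then 1 else 0)" for i j
    by (simp add: axis_def)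
  then have "\<phi> i [e j] = (if i = j then 1 else 0)" for i j
    by (simp only: T_def vec_lambda_beta)
  then show ?thesis by (rule that)
qed

lemma independent_3I:
  fixes x y z :: "'a::real_vector"
  assumes "\<And>a b c. a *\<^sub>R x + b *\<^sub>R y + c *\<^sub>R z = 0 \<Longrightarrow> a = 0 \<and> b = 0 \<and> c = 0"
  shows "independent {x, y, z}" "card {x, y, z} = 3"
proof -
  have neq: "x \<noteq> y" "x \<noteq> z" "y \<noteq> z"
    using assms[of 1 "-1" 0] assms[of 1 0 "-1"] assms[of 0 1 "-1"] by auto
  then show "card {x, y, z} = 3" by simp
  show "independent {x, y, z}"
    using neq assms by (auto simp: dependent_finite add.assoc[symmetric])
qed

text \<open>The bound needs a finite-dimensional ambient space, because \<^term>\<open>dim\<close> is 0 on sets whose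
  span has infinite dimension.\<close>

lemma independent_card_le_dim_span:
  fixes G S W :: "'a::real_vector set"
  assumes "finite G" "W \<subseteq> span G" "independent S" "S \<subseteq> span W"
  shows "card S \<le> dim W"
proof -
  obtain C where C: "C \<subseteq> W" "independent C" "W \<subseteq> span C" "card C = dim W"
    using basis_exists by blast
  have "finite C"
    using independent_span_bound[OF assms(1) C(2)] C(1) assms(2) by blast
  moreover have "S \<subseteq> span C"
    using assms(4) C(3) by (meson span_minimal subspace_span order_trans)
  ultimately show ?thesis
    using independent_span_bound[OF _ assms(3)] C(4) by metis
qed

section \<open>Exterior products with one-forms\<close>

lemma linear_wedge_right: "linear (\<lambda>\<zeta>. \<eta> \<and>\<^sub>\<Lambda> \<zeta>)"
  by (rule linearI) (simp_all add: wedge_def fun_eq_iff algebra_simps sum.distrib sum_distrib_left)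

lemma shuffle_sign_singleton: "shuffle_sign {i} = (-1) ^ i"
proof -
  have "{(a, j). a \<in> {i} \<and> j < a \<and> j \<notin> {i}} = Pair i ` {..<i}" by auto
  then show ?thesis by (simp add: shuffle_sign_def card_image inj_on_def)
qed

lemma shuffle_sign_cosingleton:
  assumes "i < n" shows "shuffle_sign ({..<n} - {i}) = (-1) ^ (n - 1 - i)"
proof -
  have "{(a, j). a \<in> {..<n} - {i} \<and> j < a \<and> j \<notin> {..<n} - {i}} = (\<lambda>a. (a, i)) ` {i<..<n}"
    using assms by auto
  then show ?thesis by (simp add: shuffle_sign_def card_image inj_on_def)
qed

lemma nths_single_index: "i < length xs \<Longrightarrow> nths xs {i} = [xs ! i]"
proof (induction xs arbitrary: i)
  case (Cons x xs)
  then show ?case by (cases i) (simp_all add: nths_Cons)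
qed simp

lemma nths_cong_index:
  assumes "\<And>i. i < length xs \<Longrightarrow> i \<in> A \<longleftrightarrow> i \<in> B"
  shows "nths xs A = nths xs B"
  using assms unfolding nths_def by (intro arg_cong[where f = "map fst"] filter_cong) (auto simp: set_zip)

text \<open>Only the shuffles that pass exactly one argument to \<open>\<alpha>\<close> contribute, which leaves the usual
  expansion along one position.\<close>

lemma wedge_one_form_left:
  assumes "homogeneous 1 \<alpha>"
  shows "(\<alpha> \<and>\<^sub>\<Lambda> \<eta>) xs = (\<Sum>i<length xs. (-1) ^ i * \<alpha> [xs ! i] * \<eta> (nths xs (- {i})))"
proof -
  let ?g = "\<lambda>I. shuffle_sign I * \<alpha> (nths xs I) * \<eta> (nths xs (- I))"
  have "(\<alpha> \<and>\<^sub>\<Lambda> \<eta>) xs = (\<Sum>I\<in>(\<lambda>i. {i}) ` {..<length xs}. ?g I)"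
    unfolding wedge_def
  proof (rule sum.mono_neutral_right)
    show "\<forall>I\<in>Pow {..<length xs} - (\<lambda>i. {i}) ` {..<length xs}. ?g I = 0"
    proof
      fix I assume I: "I \<in> Pow {..<length xs} - (\<lambda>i. {i}) ` {..<length xs}"
      have "{i. i < length xs \<and> i \<in> I} = I" using I by auto
      moreover have "card I \<noteq> 1" using I by (auto simp: card_1_singleton_iff)
      ultimately have "length (nths xs I) \<noteq> 1" by (simp add: length_nths)
      then show "?g I = 0" using assms unfolding homogeneous_def by simp
    qed
  qed auto
  also have "\<dots> = (\<Sum>i<length xs. ?g {i})" by (simp add: sum.reindex)
  also have "\<dots> = (\<Sum>i<length xs. (-1) ^ i * \<alpha> [xs ! i] * \<eta> (nths xs (- {i})))"
    by (rule sum.cong) (simp_all add: shuffle_sign_singleton nths_single_index)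
  finally show ?thesis .
qed


lemma wedge_one_form_right:
  assumes "homogeneous 1 \<alpha>"
  shows "(\<eta> \<and>\<^sub>\<Lambda> \<alpha>) xs =
    (\<Sum>i<length xs. (-1) ^ (length xs - 1 - i) * \<eta> (nths xs (- {i})) * \<alpha> [xs ! i])"
proof -
  let ?n = "length xs"
  let ?g = "\<lambda>I. shuffle_sign I * \<eta> (nths xs I) * \<alpha> (nths xs (- I))"
  let ?c = "\<lambda>i. {..<?n} - {i}"
  have "(\<eta> \<and>\<^sub>\<Lambda> \<alpha>) xs = (\<Sum>I\<in>?c ` {..<?n}. ?g I)"
    unfolding wedge_def
  proof (rule sum.mono_neutral_right)
    show "\<forall>I\<in>Pow {..<?n} - ?c ` {..<?n}. ?g I = 0"
    proof
      fix I assume I: "I \<in> Pow {..<?n} - ?c ` {..<?n}"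
      have "card {i. i < ?n \<and> i \<in> - I} \<noteq> 1"
      proof
        assume "card {i. i < ?n \<and> i \<in> - I} = 1"
        then obtain i where i: "{i. i < ?n \<and> i \<in> - I} = {i}" by (auto simp: card_1_singleton_iff)
        then have "I = ?c i" "i < ?n" using I by blast+
        then show False using I by blast
      qed
      then have "length (nths xs (- I)) \<noteq> 1" by (simp add: length_nths)
      then show "?g I = 0" using assms unfolding homogeneous_def by simp
    qed
  qed auto
  also have "\<dots> = (\<Sum>i<?n. ?g (?c i))"
  proof (rule sum.reindex_cong)
    show "inj_on ?c {..<?n}" by (rule inj_onI) blast
  qed auto
  also have "\<dots> = (\<Sum>i<?n. (-1) ^ (?n - 1 - i) * \<eta> (nths xs (- {i})) * \<alpha> [xs ! i])"
  proof (rule sum.cong)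
    fix i assume "i \<in> {..<?n}"
    moreover have "nths xs (?c i) = nths xs (- {i})" "nths xs (- ?c i) = nths xs {i}" for i
      by (rule nths_cong_index; simp)+
    ultimately show "?g (?c i) = (-1) ^ (?n - 1 - i) * \<eta> (nths xs (- {i})) * \<alpha> [xs ! i]"
      by (simp add: shuffle_sign_cosingleton nths_single_index)
  qed simp
  finally show ?thesis .
qed

lemma wedge_2_1_eval:
  assumes "\<alpha> \<in> alt_forms 1"
  shows "(\<eta> \<and>\<^sub>\<Lambda> \<alpha>) [x, y, z] = \<eta> [x, y] * \<alpha> [z] - \<eta> [x, z] * \<alpha> [y] + \<eta> [y, z] * \<alpha> [x]"
  by (simp add: wedge_one_form_right[OF homogeneous_alt_forms[OF assms]] nths_Cons lessThan_Suc
      eval_nat_numeral)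

lemma wedge_1_1_eval:
  assumes "\<alpha> \<in> alt_forms 1"
  shows "(\<alpha> \<and>\<^sub>\<Lambda> \<eta>) [x, y] = \<alpha> [x] * \<eta> [y] - \<alpha> [y] * \<eta> [x]"
  by (simp add: wedge_one_form_left[OF homogeneous_alt_forms[OF assms]] nths_Cons lessThan_Suc)

lemma wedge_1_2_eval:
  assumes "\<alpha> \<in> alt_forms 1"
  shows "(\<alpha> \<and>\<^sub>\<Lambda> \<eta>) [x, y, z] = \<alpha> [x] * \<eta> [y, z] - \<alpha> [y] * \<eta> [x, z] + \<alpha> [z] * \<eta> [x, y]"
  by (simp add: wedge_one_form_left[OF homogeneous_alt_forms[OF assms]] nths_Cons lessThan_Suc)

lemma wedge_1_3_eval:
  assumes "\<alpha> \<in> alt_forms 1"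
  shows "(\<alpha> \<and>\<^sub>\<Lambda> \<eta>) [x, y, z, w] =
    \<alpha> [x] * \<eta> [y, z, w] - \<alpha> [y] * \<eta> [x, z, w] + \<alpha> [z] * \<eta> [x, y, w] - \<alpha> [w] * \<eta> [x, y, z]"
  by (simp add: wedge_one_form_left[OF homogeneous_alt_forms[OF assms]] nths_Cons lessThan_Suc)

lemma homogeneous_wedge:
  assumes "homogeneous p \<eta>" "homogeneous q \<zeta>"
  shows "homogeneous (p + q) (\<eta> \<and>\<^sub>\<Lambda> \<zeta>)"
  unfolding homogeneous_def
proof (intro allI impI)
  fix xs :: "'a list" assume xs: "length xs \<noteq> p + q"
  have "\<eta> (nths xs I) = 0 \<or> \<zeta> (nths xs (- I)) = 0" for I
  proof -
    have "length (nths xs I) + length (nths xs (- I)) =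
        card ({i. i < length xs \<and> i \<in> I} \<union> {i. i < length xs \<and> i \<in> - I})"
      unfolding length_nths by (subst card_Un_disjoint) auto
    also have "{i. i < length xs \<and> i \<in> I} \<union> {i. i < length xs \<and> i \<in> - I} = {..<length xs}" by auto
    finally show ?thesis using assms xs unfolding homogeneous_def by (metis card_lessThan)
  qed
  then show "(\<eta> \<and>\<^sub>\<Lambda> \<zeta>) xs = 0"
    unfolding wedge_def by (intro sum.neutral) (metis mult_eq_0_iff)
qed

lemma wedge_alt_forms_1_1:
  assumes \<phi>: "\<phi> \<in> alt_forms 1" and \<psi>: "\<psi> \<in> alt_forms 1"
  shows "\<phi> \<and>\<^sub>\<Lambda> \<psi> \<in> alt_forms 2"
proof -
  have lin: "linear (\<lambda>v. \<phi> [v])" "linear (\<lambda>v. \<psi> [v])"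
    using \<phi> \<psi> unfolding alt_forms_1_iff by blast+
  note ev = linear_add[OF lin(1)] linear_add[OF lin(2)] linear_cmul[OF lin(1)] linear_cmul[OF lin(2)]
  have "(\<phi> \<and>\<^sub>\<Lambda> \<psi>) xs = 0" if "length xs \<noteq> 2" for xs
    using homogeneous_wedge[OF \<phi>[THEN homogeneous_alt_forms] \<psi>[THEN homogeneous_alt_forms]] that
    by (simp add: homogeneous_def)
  then show ?thesis
    unfolding alt_forms_2_iff wedge_1_1_eval[OF \<phi>]
    by (auto intro!: linearI simp: ev algebra_simps)
qed

lemma wedge_alt_forms_2_1:
  assumes \<eta>: "\<eta> \<in> alt_forms 2" and \<psi>: "\<psi> \<in> alt_forms 1"
  shows "\<eta> \<and>\<^sub>\<Lambda> \<psi> \<in> alt_forms 3"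
proof -
  have lin: "linear (\<lambda>x. \<eta> [x, y])" "linear (\<lambda>y. \<eta> [x, y])" "linear (\<lambda>v. \<psi> [v])"
    and diag: "\<eta> [x, x] = 0" for x y
    using \<eta> \<psi> unfolding alt_forms_1_iff alt_forms_2_iff by blast+
  note ev = linear_add[OF lin(1)] linear_add[OF lin(2)] linear_add[OF lin(3)]
    linear_cmul[OF lin(1)] linear_cmul[OF lin(2)] linear_cmul[OF lin(3)]
  have "(\<eta> \<and>\<^sub>\<Lambda> \<psi>) xs = 0" if "length xs \<noteq> 3" for xs
    using homogeneous_wedge[OF \<eta>[THEN homogeneous_alt_forms] \<psi>[THEN homogeneous_alt_forms]] that
    by (simp add: homogeneous_def)
  moreover have "\<eta> [x, y] * \<psi> [x] + \<eta> [y, x] * \<psi> [x] = 0" for x y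
    using alt_forms_2_swap[OF \<eta>, of x y] by simp
  ultimately show ?thesis
    unfolding alt_forms_3_iff wedge_2_1_eval[OF \<psi>]
    by (auto intro!: linearI simp: ev diag algebra_simps)
qed

lemma homogeneous_wedge_1_2_1:
  assumes "\<alpha> \<in> alt_forms 1" "\<omega> \<in> alt_forms 2" "\<beta> \<in> alt_forms 1"
  shows "homogeneous 4 (\<beta> \<and>\<^sub>\<Lambda> (\<omega> \<and>\<^sub>\<Lambda> \<alpha>))" "homogeneous 4 (\<alpha> \<and>\<^sub>\<Lambda> (\<beta> \<and>\<^sub>\<Lambda> \<omega>))"
proof -
  note h = assms[THEN homogeneous_alt_forms]
  show "homogeneous 4 (\<beta> \<and>\<^sub>\<Lambda> (\<omega> \<and>\<^sub>\<Lambda> \<alpha>))"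
    using homogeneous_wedge[OF h(3) homogeneous_wedge[OF h(2) h(1)]] by simp
  show "homogeneous 4 (\<alpha> \<and>\<^sub>\<Lambda> (\<beta> \<and>\<^sub>\<Lambda> \<omega>))"
    using homogeneous_wedge[OF h(1) homogeneous_wedge[OF h(3) h(2)]] by (simp add: eval_nat_numeral)
qed

text \<open>This is why the closed forms \<open>\<omega>\<^sub>2 \<and> \<alpha>\<close> and \<open>\<omega>\<^sub>3 \<and> \<alpha>\<close> of a hypo structure lie in the kernel of
  \<^term>\<open>L_op \<alpha>\<close>.\<close>

lemma wedge_self_wedge_eq_0:
  assumes \<omega>: "\<omega> \<in> alt_forms 2" and \<alpha>: "\<alpha> \<in> alt_forms 1"
  shows "\<alpha> \<and>\<^sub>\<Lambda> (\<omega> \<and>\<^sub>\<Lambda> \<alpha>) = 0"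
proof (rule homogeneous_eqI[of 4])
  fix xs :: "'a list" assume "length xs = 4"
  then obtain x y z w where "xs = [x, y, z, w]" by (auto simp: numeral_eq_Suc length_Suc_conv)
  then show "(\<alpha> \<and>\<^sub>\<Lambda> (\<omega> \<and>\<^sub>\<Lambda> \<alpha>)) xs = 0 xs"
    by (simp add: wedge_1_3_eval[OF \<alpha>] wedge_2_1_eval[OF \<alpha>] algebra_simps)
qed (use homogeneous_wedge_1_2_1[OF \<alpha> \<omega> \<alpha>] homogeneous_zero in auto)

text \<open>The 1-form \<open>\<alpha>\<close> passes the 3-form \<open>\<beta> \<and> \<omega>\<close>, whence the sign.\<close>

lemma wedge_1_2_1_shift:
  assumes \<omega>: "\<omega> \<in> alt_forms 2" and \<alpha>: "\<alpha> \<in> alt_forms 1" and \<beta>: "\<beta> \<in> alt_forms 1"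
  shows "\<beta> \<and>\<^sub>\<Lambda> (\<omega> \<and>\<^sub>\<Lambda> \<alpha>) = - (\<alpha> \<and>\<^sub>\<Lambda> (\<beta> \<and>\<^sub>\<Lambda> \<omega>))"
proof (rule homogeneous_eqI[of 4])
  fix xs :: "'a list" assume "length xs = 4"
  then obtain x y z w where "xs = [x, y, z, w]" by (auto simp: numeral_eq_Suc length_Suc_conv)
  then show "(\<beta> \<and>\<^sub>\<Lambda> (\<omega> \<and>\<^sub>\<Lambda> \<alpha>)) xs = (- (\<alpha> \<and>\<^sub>\<Lambda> (\<beta> \<and>\<^sub>\<Lambda> \<omega>))) xs"
    by (simp add: wedge_1_3_eval[OF \<alpha>] wedge_1_3_eval[OF \<beta>] wedge_2_1_eval[OF \<alpha>]
        wedge_1_2_eval[OF \<beta>] algebra_simps)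
qed (use homogeneous_wedge_1_2_1[OF \<alpha> \<omega> \<beta>] homogeneous_uminus in auto)

section \<open>The three two-forms of a hypo structure\<close>

text \<open>An instance of \<open>independent_functionals_dual_vectors\<close>, with the index set \<open>{1..5}\<close> identified with
  the 5-element type.\<close>

lemma dual_basis5_dual_vectors:
  fixes f :: "nat \<Rightarrow> 'g::real_vector form"
  assumes f: "dual_basis5 f"
  obtains e where "\<And>i j. i \<in> {1..5} \<Longrightarrow> j \<in> {1..5} \<Longrightarrow> f i [e j] = (if i = j then 1 else 0)"
proof -
  have "card (UNIV :: 5 set) = card {1..5::nat}" by simp
  then obtain h :: "5 \<Rightarrow> nat" where h: "bij_betw h UNIV {1..5}"
    using finite_same_card_bij[of "UNIV :: 5 set" "{1..5::nat}"] by auto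
  have range_h: "range h = {1..5}" "inj h" using h by (auto simp: bij_betw_def)
  have "inj (f \<circ> h)"
    using f range_h unfolding dual_basis5_def by (simp add: comp_inj_on)
  moreover have "independent (range (f \<circ> h))"
    using f unfolding dual_basis5_def image_comp[symmetric] range_h(1) by blast
  moreover have "(f \<circ> h) i \<in> alt_forms 1" for i
    using f range_h(1) span_base[of "f (h i)" "f ` {1..5}"] unfolding dual_basis5_def by auto
  ultimately obtain e where e: "\<And>i j. (f \<circ> h) i [e j] = (if i = j then 1 else 0)"
    using independent_functionals_dual_vectors[of "f \<circ> h"] by blast
  have "f i [e (inv h j)] = (if i = j then 1 else 0)" if "i \<in> {1..5}" "j \<in> {1..5}" for i j
  proof -
    have "i \<in> range h" "j \<in> range h" using that unfolding range_h(1) .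
    then obtain i' j' where ij: "i = h i'" "j = h j'" by blast
    show ?thesis
      using e[of i' j'] unfolding ij by (simp add: inv_f_f[OF range_h(2)] inj_eq[OF range_h(2)])
  qed
  then show ?thesis by (rule that)
qed

text \<open>Write \<open>u\<^sub>i\<close> for the coordinates of \<open>\<beta>\<close>. Since \<open>f\<^sup>5\<close> vanishes on \<open>e\<^sub>1, \<dots>, e\<^sub>4\<close>, evaluating the
  4-form at \<open>(e\<^sub>i, e\<^sub>j, e\<^sub>k, e\<^sub>5)\<close> with \<open>i < j < k < 5\<close> gives, up to sign, the four components of
  \<open>\<beta> \<and> (a \<omega>\<^sub>1 + b \<omega>\<^sub>2 + c \<omega>\<^sub>3)\<close> on the kernel of \<open>f\<^sup>5\<close>. The \<open>\<omega>\<^sub>i\<close> form a quaternionic triple there,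
  so the product with a 1-form multiplies norms: the squares of these components add up to
  \<open>(u\<^sub>1\<^sup>2 + u\<^sub>2\<^sup>2 + u\<^sub>3\<^sup>2 + u\<^sub>4\<^sup>2) (a\<^sup>2 + b\<^sup>2 + c\<^sup>2)\<close>, where the first factor is positive because \<open>\<beta>\<close> is
  not a multiple of \<open>f\<^sup>5\<close>.\<close>

lemma hypo_wedge_injective:
  fixes f :: "nat \<Rightarrow> 'g::real_vector form"
  assumes f: "dual_basis5 f" and \<beta>: "\<beta> \<in> alt_forms 1" "\<beta> \<notin> span {f 5}"
    and zero: "f 5 \<and>\<^sub>\<Lambda> (\<beta> \<and>\<^sub>\<Lambda> (a *\<^sub>R (f 1 \<and>\<^sub>\<Lambda> f 2 + f 3 \<and>\<^sub>\<Lambda> f 4) +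
      b *\<^sub>R (f 1 \<and>\<^sub>\<Lambda> f 3 + f 4 \<and>\<^sub>\<Lambda> f 2) + c *\<^sub>R (f 1 \<and>\<^sub>\<Lambda> f 4 + f 2 \<and>\<^sub>\<Lambda> f 3))) = 0"
  shows "a = 0 \<and> b = 0 \<and> c = 0"
proof -
  obtain e where e: "\<And>i j. i \<in> {1..5} \<Longrightarrow> j \<in> {1..5} \<Longrightarrow> f i [e j] = (if i = j then 1 else 0)"
    using dual_basis5_dual_vectors[OF f] by blast
  have f1: "f i \<in> alt_forms 1" if "i \<in> {1..5}" for i
    using f that span_base[of "f i" "f ` {1..5}"] unfolding dual_basis5_def by auto
  define u where "u i = \<beta> [e i]" for i
  have "\<beta> \<in> span (f ` {1..5})" using f \<beta>(1) unfolding dual_basis5_def by blast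
  then obtain t where "\<beta> = (\<Sum>x\<in>f ` {1..5}. t x *\<^sub>R x)"
    by (auto simp: span_finite)
  then have t: "\<beta> = (\<Sum>i\<in>{1..5}. t (f i) *\<^sub>R f i)"
    using f unfolding dual_basis5_def by (simp add: sum.reindex)
  have tu: "t (f j) = u j" if "j \<in> {1..5}" for j
  proof -
    have "u j = (\<Sum>i\<in>{1..5}. t (f i) * f i [e j])"
      unfolding u_def by (subst t) (simp only: sum_fun_apply scaleR_fun_apply real_scaleR_def)
    also have "\<dots> = (\<Sum>i\<in>{1..5}. if i = j then t (f i) else 0)"
      using that by (intro sum.cong) (simp_all add: e)
    also have "\<dots> = t (f j)" using that by simp
    finally show ?thesis ..
  qed
  have \<beta>_sum: "\<beta> = (\<Sum>i\<in>{1..5}. u i *\<^sub>R f i)"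
    unfolding t by (rule sum.cong) (simp_all only: tu)
  have "(u 1)\<^sup>2 + (u 2)\<^sup>2 + (u 3)\<^sup>2 + (u 4)\<^sup>2 \<noteq> 0"
  proof
    assume "(u 1)\<^sup>2 + (u 2)\<^sup>2 + (u 3)\<^sup>2 + (u 4)\<^sup>2 = 0"
    then have "u 1 = 0 \<and> u 2 = 0 \<and> u 3 = 0 \<and> u 4 = 0"
      by (simp add: add_nonneg_eq_0_iff)
    then have "\<beta> = u 5 *\<^sub>R f 5"
      by (simp add: \<beta>_sum numeral_eq_Suc sum.atLeast_Suc_atMost)
    then show False using \<beta>(2) span_scale[OF span_base[of "f 5" "{f 5}"], of "u 5"] by auto
  qed
  let ?\<omega> = "a *\<^sub>R (f 1 \<and>\<^sub>\<Lambda> f 2 + f 3 \<and>\<^sub>\<Lambda> f 4) +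
      b *\<^sub>R (f 1 \<and>\<^sub>\<Lambda> f 3 + f 4 \<and>\<^sub>\<Lambda> f 2) + c *\<^sub>R (f 1 \<and>\<^sub>\<Lambda> f 4 + f 2 \<and>\<^sub>\<Lambda> f 3)"
  have "(f 5 \<and>\<^sub>\<Lambda> (\<beta> \<and>\<^sub>\<Lambda> ?\<omega>)) [e i, e j, e k, e 5] = 0" for i j k
    using zero by simp
  note this[of 1 2 3] this[of 1 2 4] this[of 1 3 4] this[of 2 3 4]
  then have eqs: "u 1 * c - u 2 * b + u 3 * a = 0" "- u 1 * b - u 2 * c + u 4 * a = 0"
    "u 1 * a - u 3 * c + u 4 * b = 0" "u 2 * a + u 3 * b + u 4 * c = 0"
    by (simp_all add: wedge_1_3_eval[OF f1] wedge_1_2_eval[OF \<beta>(1)] wedge_1_1_eval[OF f1] e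
        u_def[symmetric])
  have "((u 1)\<^sup>2 + (u 2)\<^sup>2 + (u 3)\<^sup>2 + (u 4)\<^sup>2) * (a\<^sup>2 + b\<^sup>2 + c\<^sup>2) =
      (u 1 * c - u 2 * b + u 3 * a)\<^sup>2 + (- u 1 * b - u 2 * c + u 4 * a)\<^sup>2 +
      (u 1 * a - u 3 * c + u 4 * b)\<^sup>2 + (u 2 * a + u 3 * b + u 4 * c)\<^sup>2"
    by (simp add: power2_eq_square algebra_simps)
  also have "\<dots> = 0" unfolding eqs by simp
  finally have "a\<^sup>2 + b\<^sup>2 + c\<^sup>2 = 0"
    using \<open>_ \<noteq> 0\<close> by simp
  then show ?thesis
    by (simp add: add_nonneg_eq_0_iff)
qed

section \<open>Obstruction to a hypo structure with prescribed almost-contact form\<close>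

theorem proposition7:
  fixes bracket :: "'g::real_vector \<Rightarrow> 'g \<Rightarrow> 'g"
    and \<alpha> \<beta> :: "'g form"
    and V :: "'g form set"
  assumes "lie_algebra bracket"
    and "dim (UNIV :: 'g set) = 5"
    and "\<alpha> \<in> alt_forms 1" and "\<beta> \<in> alt_forms 1"
    and "\<alpha> \<noteq> \<beta>" and "independent {\<alpha>, \<beta>}"
    and "V = L_ker \<alpha> 3 \<inter> closed_forms bracket 3"
    and "dim (L_op \<beta> ` V) < 2 \<or>
         dim (L_op \<beta> ` V) = 2 \<and> L_op \<alpha> ` L_op \<beta> ` closed_forms bracket 2 \<subseteq> L_op \<beta> ` V"
  shows "\<not> (\<exists>\<omega>\<^sub>1 \<omega>\<^sub>2 \<omega>\<^sub>3. hypo_structure bracket \<alpha> \<omega>\<^sub>1 \<omega>\<^sub>2 \<omega>\<^sub>3)"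
proof
  assume "\<exists>\<omega>\<^sub>1 \<omega>\<^sub>2 \<omega>\<^sub>3. hypo_structure bracket \<alpha> \<omega>\<^sub>1 \<omega>\<^sub>2 \<omega>\<^sub>3"
  then obtain \<omega>\<^sub>1 \<omega>\<^sub>2 \<omega>\<^sub>3 f where f: "dual_basis5 f" "\<alpha> = f 5"
    and \<omega>: "\<omega>\<^sub>1 = f 1 \<and>\<^sub>\<Lambda> f 2 + f 3 \<and>\<^sub>\<Lambda> f 4" "\<omega>\<^sub>2 = f 1 \<and>\<^sub>\<Lambda> f 3 + f 4 \<and>\<^sub>\<Lambda> f 2"
      "\<omega>\<^sub>3 = f 1 \<and>\<^sub>\<Lambda> f 4 + f 2 \<and>\<^sub>\<Lambda> f 3"
    and closed: "ce_diff bracket \<omega>\<^sub>1 = 0" "ce_diff bracket (\<omega>\<^sub>2 \<and>\<^sub>\<Lambda> \<alpha>) = 0"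
      "ce_diff bracket (\<omega>\<^sub>3 \<and>\<^sub>\<Lambda> \<alpha>) = 0"
    unfolding hypo_structure_def by blast
  have f1: "f i \<in> alt_forms 1" if "i \<in> {1..5}" for i
    using f(1) that span_base[of "f i" "f ` {1..5}"] unfolding dual_basis5_def by auto
  have \<omega>_alt: "\<omega>\<^sub>1 \<in> alt_forms 2" "\<omega>\<^sub>2 \<in> alt_forms 2" "\<omega>\<^sub>3 \<in> alt_forms 2"
    unfolding \<omega> by (intro subspace_add[OF subspace_alt_forms] wedge_alt_forms_1_1 f1; simp)+
  define N where "N \<omega> = \<alpha> \<and>\<^sub>\<Lambda> (\<beta> \<and>\<^sub>\<Lambda> \<omega>)" for \<omega>
  have "N = (\<lambda>\<zeta>. \<alpha> \<and>\<^sub>\<Lambda> \<zeta>) \<circ> (\<lambda>\<zeta>. \<beta> \<and>\<^sub>\<Lambda> \<zeta>)" by (simp add: N_def fun_eq_iff)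
  then have linN: "linear N" using linear_compose[OF linear_wedge_right linear_wedge_right] by metis
  have \<beta>: "\<beta> \<notin> span {f 5}"
    using assms(5,6) independent_insert[of \<beta> "{\<alpha>}"] f(2) by (simp add: insert_commute)
  have N_inj: "a = 0 \<and> b = 0 \<and> c = 0" if "a *\<^sub>R N \<omega>\<^sub>1 + b *\<^sub>R N \<omega>\<^sub>2 + c *\<^sub>R N \<omega>\<^sub>3 = 0" for a b c
  proof (rule hypo_wedge_injective[OF f(1) assms(4) \<beta>])
    have "N (a *\<^sub>R \<omega>\<^sub>1 + b *\<^sub>R \<omega>\<^sub>2 + c *\<^sub>R \<omega>\<^sub>3) = 0"
      using that by (simp only: linear_add[OF linN] linear_cmul[OF linN])
    then show "f 5 \<and>\<^sub>\<Lambda> (\<beta> \<and>\<^sub>\<Lambda> (a *\<^sub>R (f 1 \<and>\<^sub>\<Lambda> f 2 + f 3 \<and>\<^sub>\<Lambda> f 4) +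
      b *\<^sub>R (f 1 \<and>\<^sub>\<Lambda> f 3 + f 4 \<and>\<^sub>\<Lambda> f 2) + c *\<^sub>R (f 1 \<and>\<^sub>\<Lambda> f 4 + f 2 \<and>\<^sub>\<Lambda> f 3))) = 0"
      unfolding N_def \<omega> f(2) .
  qed
  have indep: "independent {N \<omega>\<^sub>1, N \<omega>\<^sub>2, N \<omega>\<^sub>3}" "card {N \<omega>\<^sub>1, N \<omega>\<^sub>2, N \<omega>\<^sub>3} = 3"
    using independent_3I[of "N \<omega>\<^sub>1" "N \<omega>\<^sub>2" "N \<omega>\<^sub>3"] N_inj by blast+
  have in_V: "\<omega> \<and>\<^sub>\<Lambda> \<alpha> \<in> V" if "\<omega> \<in> alt_forms 2" "ce_diff bracket (\<omega> \<and>\<^sub>\<Lambda> \<alpha>) = 0" for \<omega>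
    unfolding assms(7) L_ker_def closed_forms_def L_op_def
    using that wedge_alt_forms_2_1[OF that(1) assms(3)] wedge_self_wedge_eq_0[OF that(1) assms(3)]
    by simp
  have N_span: "N \<omega> \<in> span (L_op \<beta> ` V)" if "\<omega> \<in> alt_forms 2" "ce_diff bracket (\<omega> \<and>\<^sub>\<Lambda> \<alpha>) = 0" for \<omega>
  proof -
    have "L_op \<beta> (\<omega> \<and>\<^sub>\<Lambda> \<alpha>) \<in> span (L_op \<beta> ` V)"
      using in_V[OF that] by (simp add: span_base)
    moreover have "L_op \<beta> (\<omega> \<and>\<^sub>\<Lambda> \<alpha>) = - N \<omega>"
      unfolding L_op_def N_def by (rule wedge_1_2_1_shift[OF that(1) assms(3,4)])
    ultimately show ?thesis by (metis add.inverse_inverse span_neg)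
  qed
  have N23: "{N \<omega>\<^sub>2, N \<omega>\<^sub>3} \<subseteq> span (L_op \<beta> ` V)"
    using N_span \<omega>_alt closed by simp
  obtain B :: "'g set" where B: "independent B" "UNIV \<subseteq> span B" "card B = 5"
    using basis_exists[of "UNIV :: 'g set"] assms(2) by metis
  have "finite B" using B(3) by (intro card_ge_0_finite) simp
  moreover have "span B = UNIV" using B(2) by blast
  ultimately obtain G :: "'g form set" where G: "finite G" "alt_forms 3 \<subseteq> span G"
    using finite_dim_alt_forms by blast
  have "L_op \<beta> ` V \<subseteq> L_op \<beta> ` span G"
    using G(2) unfolding assms(7) L_ker_def by blast
  also have "\<dots> = span (L_op \<beta> ` G)"
    using linear_span_image[OF linear_wedge_right[of \<beta>], of G] by (simp add: L_op_def[abs_def])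
  finally have card_le: "card S \<le> dim (L_op \<beta> ` V)"
    if "independent S" "S \<subseteq> span (L_op \<beta> ` V)" for S
    using independent_card_le_dim_span[OF finite_imageI[OF G(1)]] that by blast
  have "independent {N \<omega>\<^sub>2, N \<omega>\<^sub>3}" using indep(1) by (rule independent_mono) auto
  moreover have "card {N \<omega>\<^sub>2, N \<omega>\<^sub>3} = 2"
    using N_inj[of 0 1 "-1"] by (auto simp: card_insert_if)
  ultimately have "2 \<le> dim (L_op \<beta> ` V)" using card_le N23 by metis
  with assms(8) have dim: "dim (L_op \<beta> ` V) = 2"
    and sub: "L_op \<alpha> ` L_op \<beta> ` closed_forms bracket 2 \<subseteq> L_op \<beta> ` V" by auto
  have "\<omega>\<^sub>1 \<in> closed_forms bracket 2"
    using \<omega>_alt closed by (simp add: closed_forms_def)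
  then have "N \<omega>\<^sub>1 \<in> L_op \<beta> ` V"
    using sub by (auto simp: N_def L_op_def)
  then have "{N \<omega>\<^sub>1, N \<omega>\<^sub>2, N \<omega>\<^sub>3} \<subseteq> span (L_op \<beta> ` V)"
    using N23 by (simp add: span_base)
  from card_le[OF indep(1) this] show False
    using indep(2) dim by simp
qed

end
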